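(* Let $\mu$ be a Borel probability measure on $2^\omega$ and let $A\subseteq 2^\omega\times2^\omega$. If player I has a winning strategy in the two-dimensional measure game $G_2(0,A)$, then player I has a winning strategy in the measure game $G(0,B)$, where $B=\{x\in2^\omega: \text{I does not have a winning strategy in } G(0,A_x)\}$ and $A_x=\{y\in2^\omega:(x,y)\in A\}$.
   Context: $2^\omega$ is the space of infinite binary sequences with the product topology; for $t\in2^{<\omega}$, $N_t=\{x\in2^\omega:t\subseteq x\}$, and $t^\frown i$ is $t$ extended by $i$. Measure game $G(s,A)$ for $A\subseteq2^\omega$, $s\in[0,1)$: in round $n$, after II has played $t=x_0\dots x_{n-1}$, I plays $(m_{t^\frown0},m_{t^\frown1})$, then II plays $x_n$; $m_\emptyset=m_0+m_1$. I must obey: all $m_t$ rational; $m_0+m_1>s$; $0\le m_t\le\mu(N_t)$; $\mu(N_t)>0\Rightarrow m_t<\mu(N_t)$; $m_{t^\frown0}+m_{t^\frown1}=m_t$. II must obey: $x_n\in\{0,1\}$ and $m_{x_0\dots x_n}\ne0$. First rule-violator loses; otherwise II wins iff $(x_0,x_1,\dots)\in A$. The game $G_2(s,A)$ for $A\subseteq2^\omega\times2^\omega$ is the analogous game for $\mu\times\mu$: a sequence $t=(a_0,b_0)\dots(a_{n-1},b_{n-1})\in(2\times2)^{n}$ is identified with $(t_0,t_1)=(a_0\dots a_{n-1},b_0\dots b_{n-1})$. In each round, after II has played $t$, I plays four numbers $m_{t^\frown(i,j)}$, $(i,j)\in2\times2$, and II plays $x_n\in2\times2$. I must obey: all $m_t$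 rational; $m_{(0,0)}+m_{(0,1)}+m_{(1,0)}+m_{(1,1)}>s$; $0\le m_t\le(\mu\times\mu)(N_{t_0}\times N_{t_1})$; if $(\mu\times\mu)(N_{t_0}\times N_{t_1})>0$ then $m_t<(\mu\times\mu)(N_{t_0}\times N_{t_1})$; $\sum_{(i,j)}m_{t^\frown(i,j)}=m_t$. II must obey $x_n\in2\times2$ and $m_{x_0\dots x_n}\ne0$. If both follow the rules, II's moves determine $(x,y)\in2^\omega\times2^\omega$ and II wins iff $(x,y)\in A$. *)

theory Defs
  imports "HOL-Probability.Probability"
begin

text \<open>
  The Cantor space is the type \<^typ>\<open>nat \<Rightarrow> bool\<close> with its library (product) topology.
\<close>

definition cyl :: "bool list \<Rightarrow> (nat \<Rightarrow> bool) set" where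
  "cyl t = {x. \<forall>i<length t. x i = t ! i}"

definition initial :: "(nat \<Rightarrow> 'i) \<Rightarrow> nat \<Rightarrow> 'i list" where
  "initial x n = map x [0..<n]"

text \<open>
  Both measure games are instances of one game, in which II chooses elements of a finite
  alphabet \<open>'i\<close> and I plays numbers bounded by \<open>w t\<close>, the measure of the basic open set
  given by the word \<open>t\<close>.  A run is a pair \<open>(m, x)\<close>: in round \<open>n\<close>, I plays the numbers
  \<open>m n i\<close> (written \<open>m\<close> indexed by \<open>x\<^sub>0 \<dots> x\<^sub>n\<^sub>-\<^sub>1 i\<close> on paper) and then II plays \<open>x n\<close>.
  That II plays a letter of the alphabet is enforced by typing.
\<close>

text \<open>\<open>pos_mass m x n\<close> is the number assigned to the word \<open>x\<^sub>0 \<dots> x\<^sub>n\<^sub>-\<^sub>1\<close> during the run.\<close>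

fun pos_mass :: "(nat \<Rightarrow> 'i::finite \<Rightarrow> real) \<Rightarrow> (nat \<Rightarrow> 'i) \<Rightarrow> nat \<Rightarrow> real" where
  "pos_mass m x 0 = (\<Sum>i\<in>UNIV. m 0 i)"
| "pos_mass m x (Suc n) = m n (x n)"

definition mass_ok :: "('i list \<Rightarrow> real) \<Rightarrow> 'i list \<Rightarrow> real \<Rightarrow> bool" where
  "mass_ok w t v \<longleftrightarrow> v \<in> \<rat> \<and> 0 \<le> v \<and> v \<le> w t \<and> (w t > 0 \<longrightarrow> v < w t)"

text \<open>
  The conjunct on \<open>pos_mass m x n\<close> matters only for \<open>n = 0\<close> (the empty word); for larger \<open>n\<close>
  it repeats a rule checked one round earlier.
\<close>

definition legal_I ::
  "('i::finite list \<Rightarrow> real) \<Rightarrow> real \<Rightarrow> (nat \<Rightarrow> 'i \<Rightarrow> real) \<Rightarrow> (nat \<Rightarrow> 'i) \<Rightarrow> nat \<Rightarrow> bool" where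
  "legal_I w s m x n \<longleftrightarrow>
     mass_ok w (initial x n) (pos_mass m x n) \<and>
     (\<forall>i. mass_ok w (initial x n @ [i]) (m n i)) \<and>
     (\<Sum>i\<in>UNIV. m n i) = pos_mass m x n \<and>
     (n = 0 \<longrightarrow> (\<Sum>i\<in>UNIV. m n i) > s)"

definition legal_II :: "(nat \<Rightarrow> 'i \<Rightarrow> real) \<Rightarrow> (nat \<Rightarrow> 'i) \<Rightarrow> nat \<Rightarrow> bool" where
  "legal_II m x n \<longleftrightarrow> m n (x n) \<noteq> 0"

text \<open>
  I wins if the first violation of a rule is by II (I moves first in each round), or if there is
  no violation and the sequence played by II lies outside the payoff set \<open>P\<close>.
\<close>

definition I_wins_run ::
  "('i::finite list \<Rightarrow> real) \<Rightarrow> real \<Rightarrow> (nat \<Rightarrow> 'i) set \<Rightarrow>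
   (nat \<Rightarrow> 'i \<Rightarrow> real) \<Rightarrow> (nat \<Rightarrow> 'i) \<Rightarrow> bool" where
  "I_wins_run w s P m x \<longleftrightarrow>
     (\<exists>n. \<not> legal_II m x n \<and> (\<forall>k\<le>n. legal_I w s m x k) \<and> (\<forall>k<n. legal_II m x k)) \<or>
     (\<forall>n. legal_I w s m x n \<and> legal_II m x n) \<and> x \<notin> P"

text \<open>A strategy for I maps the word played so far by II to the next move of I.\<close>

definition winning_strategy_I ::
  "('i::finite list \<Rightarrow> real) \<Rightarrow> real \<Rightarrow> (nat \<Rightarrow> 'i) set \<Rightarrow> ('i list \<Rightarrow> 'i \<Rightarrow> real) \<Rightarrow> bool" where
  "winning_strategy_I w s P \<sigma> \<longleftrightarrow> (\<forall>x. I_wins_run w s P (\<lambda>n. \<sigma> (initial x n)) x)"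

definition I_wins_G :: "(nat \<Rightarrow> bool) measure \<Rightarrow> real \<Rightarrow> (nat \<Rightarrow> bool) set \<Rightarrow> bool" where
  "I_wins_G \<mu> s A \<longleftrightarrow> (\<exists>\<sigma>. winning_strategy_I (\<lambda>t. measure \<mu> (cyl t)) s A \<sigma>)"

definition I_wins_G2 ::
  "(nat \<Rightarrow> bool) measure \<Rightarrow> real \<Rightarrow> ((nat \<Rightarrow> bool) \<times> (nat \<Rightarrow> bool)) set \<Rightarrow> bool" where
  "I_wins_G2 \<mu> s A \<longleftrightarrow>
     (\<exists>\<sigma>. winning_strategy_I
        (\<lambda>t. measure (\<mu> \<Otimes>\<^sub>M \<mu>) (cyl (map fst t) \<times> cyl (map snd t)))
        s {z. (fst \<circ> z, snd \<circ> z) \<in> A} \<sigma>)"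

end

theory Submission
  imports Defs
begin

text \<open>
  A winning strategy of I is a consistent assignment of masses to words, dominated by the measure,
  so the runs in which II stays legal form a closed set \<open>K\<close> that has positive measure and misses
  the payoff set.  Conversely, from a closed set of positive measure missing the payoff set, I wins
  by always playing rational masses below \<open>\<mu> (K \<inter> N\<^sub>t)\<close>.  Given \<open>K = (\<Inter>n. U n)\<close> from a winning
  strategy in the two-dimensional game with total mass \<open>c\<close>, where \<open>U n\<close> depends on the first \<open>n\<close>
  coordinates only, Fubini shows that the \<open>x\<close> with \<open>\<mu> ((U n)\<^sub>x) \<ge> c / 2\<close> for all \<open>n\<close> have measure at
  least \<open>c / 2\<close>.  They form a closed set, and for each of them \<open>\<mu> (K\<^sub>x) > 0\<close>, so that I wins the
  game on the section.
\<close>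

subsection \<open>Words and cylinders\<close>

lemma length_initial [simp]: "length (initial x n) = n"
  by (simp add: initial_def)

lemma initial_0 [simp]: "initial x 0 = []"
  by (simp add: initial_def)

lemma initial_Suc: "initial x (Suc n) = initial x n @ [x n]"
  by (simp add: initial_def)

lemma nth_initial [simp]: "i < n \<Longrightarrow> initial x n ! i = x i"
  by (simp add: initial_def)

lemma take_initial: "k \<le> n \<Longrightarrow> take k (initial x n) = initial x k"
  by (simp add: initial_def take_map)

lemma initial_eq_iff: "initial x n = t \<longleftrightarrow> length t = n \<and> (\<forall>i<n. x i = t ! i)"
  by (auto simp: list_eq_iff_nth_eq)

lemma cyl_iff_initial: "x \<in> cyl t \<longleftrightarrow> initial x (length t) = t"
  by (auto simp: cyl_def initial_eq_iff)

text \<open>Identifies a word over pairs with a pair of words; this turns sets of runs of the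
  two-dimensional game into unions of rectangles.\<close>

lemma initial_pair_eq_iff:
  "initial (\<lambda>k. (x k, y k)) (length t) = t \<longleftrightarrow> x \<in> cyl (map fst t) \<and> y \<in> cyl (map snd t)"
  by (auto simp: cyl_def initial_eq_iff prod_eq_iff)

lemma cyl_snoc: "cyl t = cyl (t @ [False]) \<union> cyl (t @ [True])"
proof -
  have "x \<in> cyl (t @ [b]) \<longleftrightarrow> x \<in> cyl t \<and> x (length t) = b" for x b
    by (auto simp: cyl_iff_initial initial_Suc)
  then show ?thesis
    by auto
qed

lemma cyl_snoc_disjoint: "cyl (t @ [False]) \<inter> cyl (t @ [True]) = {}"
  by (auto simp: cyl_iff_initial initial_Suc)

lemma cyl_borel [measurable]: "cyl t \<in> sets borel"
proof -
  have "cyl t = (\<Inter>i<length t. {x. x i = t ! i})"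
    by (auto simp: cyl_def)
  also have "closed \<dots>"
    by (intro closed_INT ballI closed_Collect_eq) simp_all
  finally show ?thesis
    by (rule borel_closed)
qed

lemma finite_words [simp]: "finite {t :: 'i::finite list. length t = n \<and> Q t}"
proof -
  have "finite {t :: 'i list. set t \<subseteq> UNIV \<and> length t = n}"
    by (rule finite_lists_length_eq) simp
  then show ?thesis
    by (rule rev_finite_subset) auto
qed

text \<open>There are only finitely many words of length \<open>n\<close>, so such a set is a finite
  union of cylinders.\<close>

lemma determined_borel:
  fixes V :: "(nat \<Rightarrow> bool) set"
  assumes "\<And>x x'. initial x n = initial x' n \<Longrightarrow> x \<in> V \<Longrightarrow> x' \<in> V"
  shows "V \<in> sets borel"
proof -
  let ?T = "{t. length t = n \<and> (\<exists>x\<in>V. initial x n = t)}"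
  have "V = (\<Union>t\<in>?T. cyl t)"
  proof (intro set_eqI iffI)
    fix x
    assume "x \<in> V"
    then show "x \<in> (\<Union>t\<in>?T. cyl t)"
      by (intro UN_I[of "initial x n"]) (auto simp: cyl_iff_initial)
  next
    fix x
    assume "x \<in> (\<Union>t\<in>?T. cyl t)"
    then obtain x' where "x' \<in> V" "x \<in> cyl (initial x' n)"
      by auto
    then show "x \<in> V"
      using assms[of x' x] by (simp add: cyl_iff_initial)
  qed
  also have "\<dots> \<in> sets borel"
    by (intro sets.finite_UN finite_words cyl_borel)
  finally show ?thesis .
qed

lemma (in finite_measure) measure_INT_decseq_ge:
  assumes "\<And>n. U n \<in> sets M" "decseq U" "\<And>n. c \<le> measure M (U n)"
  shows "c \<le> measure M (\<Inter>n. U n)"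
  using finite_Lim_measure_decseq[OF _ assms(2)] assms(1,3)
  by (intro LIMSEQ_le_const[where X = "\<lambda>n. measure M (U n)"]) auto

subsection \<open>From closed sets to strategies\<close>

text \<open>This is one move of I: the current mass is divided between the two halves of a cylinder,
  each share staying below its bound. Share 0 must be allowed because a bound may be 0.\<close>

lemma rational_split:
  fixes v a b :: real
  assumes v: "v \<in> \<rat>" "0 \<le> v" "v = 0 \<or> v < a + b" and ab: "0 \<le> a" "0 \<le> b"
  obtains p q where "p \<in> \<rat>" "0 \<le> p" "p = 0 \<or> p < a" "q \<in> \<rat>" "0 \<le> q" "q = 0 \<or> q < b" "p + q = v"
proof -
  consider "v = 0" | "a = 0" "v < b" | "b = 0" "v < a" | "0 < v" "0 < a" "0 < b" "v < a + b"
    using assms by fastforce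
  then show thesis
  proof cases
    case 1
    then show ?thesis using that[of 0 0] by simp
  next
    case 2
    then show ?thesis using that[of 0 v] v by simp
  next
    case 3
    then show ?thesis using that[of v 0] v by simp
  next
    case 4
    \<comment> \<open>A number \<open>p\<close> strictly between these bounds is positive and below
      \<open>a\<close>, and \<open>v - p\<close> is positive and below \<open>b\<close>.\<close>
    then have "max 0 (v - b) < min a v"
      by auto
    then obtain p where "p \<in> \<rat>" "max 0 (v - b) < p" "p < min a v"
      using Rats_dense_in_real by blast
    then show ?thesis using that[of p "v - p"] v by auto
  qed
qed

text \<open>I keeps the mass of every word 0 or strictly below the measure of the part of
  \<open>K\<close> in its cylinder. If II avoids mass 0 forever, all prefixes of the run meet
  \<open>K\<close>, so its limit lies in the closed set \<open>K\<close> and outside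
  \<open>A\<close>.\<close>

lemma closed_imp_I_wins_G:
  fixes \<mu> :: "(nat \<Rightarrow> bool) measure" and U :: "nat \<Rightarrow> (nat \<Rightarrow> bool) set"
  assumes "prob_space \<mu>" and sets: "sets \<mu> = sets borel"
    and det: "\<And>n x x'. initial x n = initial x' n \<Longrightarrow> x \<in> U n \<Longrightarrow> x' \<in> U n"
    and pos: "measure \<mu> (\<Inter>n. U n) > 0"
    and disj: "(\<Inter>n. U n) \<inter> A = {}"
  shows "I_wins_G \<mu> 0 A"
proof -
  interpret prob_space \<mu> by fact
  let ?w = "\<lambda>t. measure \<mu> (cyl t)"
  define K where "K = (\<Inter>n. U n)"
  have cyl [measurable]: "cyl t \<in> sets \<mu>" for t
    by (simp add: sets)
  have K [measurable]: "K \<in> sets \<mu>"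
    unfolding K_def sets by (intro sets.countable_INT'' determined_borel) (auto intro: det)
  \<comment> \<open>Words are kept reversed, so that appending a letter is \<open>Cons\<close> and
    the masses can be defined by list recursion.\<close>
  define good where
    "good r v \<longleftrightarrow> v \<in> \<rat> \<and> 0 \<le> v \<and> (v = 0 \<or> v < measure \<mu> (K \<inter> cyl (rev r)))" for r v
  have "\<exists>g. good r v \<longrightarrow> (\<forall>i. good (i # r) (g i)) \<and> (\<Sum>i\<in>UNIV. g i) = v" for r v
  proof (cases "good r v")
    case True
    have "measure \<mu> (K \<inter> cyl (rev r)) =
      measure \<mu> (K \<inter> cyl (rev r @ [False])) + measure \<mu> (K \<inter> cyl (rev r @ [True]))"
      using cyl_snoc_disjoint[of "rev r"] unfolding cyl_snoc[of "rev r"] Int_Un_distrib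
      by (intro finite_measure_Union) auto
    with True have "v \<in> \<rat>" "0 \<le> v"
      "v = 0 \<or> v < measure \<mu> (K \<inter> cyl (rev r @ [False])) + measure \<mu> (K \<inter> cyl (rev r @ [True]))"
      by (auto simp: good_def)
    then obtain p q where "good (False # r) p" "good (True # r) q" "p + q = v"
      by (rule rational_split) (auto simp: good_def)
    then show ?thesis
      by (intro exI[of _ "\<lambda>i. if i then q else p"]) (auto simp: UNIV_bool)
  qed auto
  then obtain g where g: "\<And>r v i. good r v \<Longrightarrow> good (i # r) (g r v i)"
    "\<And>r v. good r v \<Longrightarrow> (\<Sum>i\<in>UNIV. g r v i) = v"
    by metis
  obtain c where c: "c \<in> \<rat>" "0 < c" "c < measure \<mu> K"
    using Rats_dense_in_real[of 0 "measure \<mu> K"] pos by (auto simp: K_def)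
  define f where "f = rec_list c (\<lambda>i r v. g r v i)"
  have f_simps: "f [] = c" "f (i # r) = g r (f r) i" for i r
    by (simp_all add: f_def)
  have good: "good r (f r)" for r
  proof (induction r)
    case Nil
    have "cyl [] = UNIV"
      by (simp add: cyl_def)
    with c show ?case
      by (simp add: f_simps good_def)
  qed (simp add: f_simps g)
  have sum_f: "(\<Sum>i\<in>UNIV. f (i # r)) = f r" for r
    using g(2)[OF good] by (simp add: f_simps)
  have ok: "mass_ok ?w t (f (rev t))" for t
  proof -
    have "measure \<mu> (K \<inter> cyl t) \<le> measure \<mu> (cyl t)"
      by (intro finite_measure_mono) auto
    then show ?thesis
      using good[of "rev t"] by (auto simp: mass_ok_def good_def)
  qed
  define \<sigma> where "\<sigma> = (\<lambda>t i. f (i # rev t))"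
  have "I_wins_run ?w 0 A (\<lambda>n. \<sigma> (initial x n)) x" for x
  proof -
    let ?m = "\<lambda>n. \<sigma> (initial x n)"
    have mass: "pos_mass ?m x n = f (rev (initial x n))" for n
      by (cases n) (simp_all add: \<sigma>_def initial_Suc sum_f)
    have "f [] > 0"
      using c by (simp add: f_simps)
    then have I: "legal_I ?w 0 ?m x n" for n
      using ok[of "initial x n"] ok[of "initial x n @ [_]"]
      unfolding legal_I_def mass by (auto simp: sum_f \<sigma>_def)
    show ?thesis
    proof (cases "\<forall>n. legal_II ?m x n")
      case True
      \<comment> \<open>A nonempty prefix has nonzero mass, so its cylinder meets \<open>K\<close>,
        and membership in \<open>U n\<close> depends on that prefix only. The moves of II say
        nothing about the empty prefix; there \<open>K \<noteq> {}\<close> suffices.\<close>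
      have "x \<in> U n" for n
      proof (cases n)
        case 0
        have "K \<noteq> {}"
          using pos by (auto simp: K_def)
        then show ?thesis
          using det[of _ 0 x] 0 by (auto simp: K_def)
      next
        case (Suc k)
        have "f (rev (initial x n)) \<noteq> 0"
          using True by (simp add: legal_II_def \<sigma>_def Suc initial_Suc)
        with good[of "rev (initial x n)"] have "measure \<mu> (K \<inter> cyl (initial x n)) > 0"
          by (auto simp: good_def)
        then obtain y where "y \<in> K" "y \<in> cyl (initial x n)"
          by (metis IntE all_not_in_conv less_irrefl measure_empty)
        then show ?thesis
          using det[of y n x] by (simp add: K_def cyl_iff_initial)
      qed
      then have "x \<notin> A"
        using disj by auto
      with True I show ?thesis
        by (simp add: I_wins_run_def)
    next
      case False
      then have "\<exists>n. \<not> legal_II ?m x n \<and> (\<forall>k<n. legal_II ?m x k)"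
        using exists_least_iff[of "\<lambda>n. \<not> legal_II ?m x n"] by auto
      with I show ?thesis
        by (auto simp: I_wins_run_def)
    qed
  qed
  then show ?thesis
    unfolding I_wins_G_def winning_strategy_I_def by blast
qed

subsection \<open>From strategies to closed sets\<close>

text \<open>These words form the tree of plays in which II has not yet broken a rule against
  \<open>\<sigma>\<close>.\<close>

definition reachable :: "('i list \<Rightarrow> 'i \<Rightarrow> real) \<Rightarrow> 'i list \<Rightarrow> bool" where
  "reachable \<sigma> t \<longleftrightarrow> (\<forall>k<length t. \<sigma> (take k t) (t ! k) \<noteq> 0)"

definition word_mass :: "('i::finite list \<Rightarrow> 'i \<Rightarrow> real) \<Rightarrow> 'i list \<Rightarrow> real" where
  "word_mass \<sigma> t = (if t = [] then \<Sum>i\<in>UNIV. \<sigma> [] i else \<sigma> (butlast t) (last t))"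

lemma reachable_Nil [simp]: "reachable \<sigma> []"
  by (simp add: reachable_def)

lemma reachable_snoc [simp]: "reachable \<sigma> (t @ [i]) \<longleftrightarrow> reachable \<sigma> t \<and> \<sigma> t i \<noteq> 0"
  by (auto simp: reachable_def less_Suc_eq nth_append)

lemma reachable_initial_iff:
  "reachable \<sigma> (initial x n) \<longleftrightarrow> (\<forall>k<n. legal_II (\<lambda>n. \<sigma> (initial x n)) x k)"
  by (auto simp: reachable_def legal_II_def take_initial)

lemma pos_mass_initial:
  "pos_mass (\<lambda>n. \<sigma> (initial x n)) x n = word_mass \<sigma> (initial x n)"
  by (cases n) (simp_all add: word_mass_def initial_Suc)

context
  fixes w :: "'i::finite list \<Rightarrow> real" and s P \<sigma>
  assumes win: "winning_strategy_I w s P \<sigma>"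
begin

text \<open>In a run won by I, a first violation can only be by II, in a round where I has still
  moved legally; reachability puts that round at \<open>n\<close> or later.\<close>

lemma reachable_imp_legal_I:
  assumes "reachable \<sigma> (initial x n)"
  shows "legal_I w s (\<lambda>n. \<sigma> (initial x n)) x n"
proof -
  have "I_wins_run w s P (\<lambda>n. \<sigma> (initial x n)) x"
    using win by (simp add: winning_strategy_I_def)
  then show ?thesis
    using assms unfolding I_wins_run_def reachable_initial_iff by (meson linorder_not_less)
qed

lemma reachable_imp_mass:
  assumes "reachable \<sigma> t"
  shows "word_mass \<sigma> t \<le> w t" "(\<Sum>i\<in>UNIV. \<sigma> t i) = word_mass \<sigma> t"
proof -
  \<comment> \<open>Any continuation of \<open>t\<close> will do: the rules for I in round
    \<open>length t\<close> depend on \<open>t\<close> alone.\<close>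
  define x where "x = (\<lambda>k. if k < length t then t ! k else undefined)"
  have x: "initial x (length t) = t"
    by (simp add: initial_eq_iff x_def)
  have "legal_I w s (\<lambda>n. \<sigma> (initial x n)) x (length t)"
    using assms by (intro reachable_imp_legal_I) (simp add: x)
  then show "word_mass \<sigma> t \<le> w t" "(\<Sum>i\<in>UNIV. \<sigma> t i) = word_mass \<sigma> t"
    by (simp_all add: legal_I_def mass_ok_def pos_mass_initial x)
qed

lemma word_mass_Nil_greater: "word_mass \<sigma> [] > s"
  using reachable_imp_legal_I[of _ 0] by (simp add: legal_I_def pos_mass_initial)

text \<open>Each move of I distributes the mass of a word among its extensions, and the extensions
  that become unreachable have mass 0, so no mass is lost from one level to the next.\<close>

lemma sum_word_mass:
  "(\<Sum>t | length t = n \<and> reachable \<sigma> t. word_mass \<sigma> t) = word_mass \<sigma> []"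
proof (induction n)
  case 0
  have "{t. length t = 0 \<and> reachable \<sigma> t} = {[]}"
    by auto
  then show ?case
    by simp
next
  case (Suc n)
  let ?T = "\<lambda>n. {t. length t = n \<and> reachable \<sigma> t}"
  have eq: "?T (Suc n) = (\<lambda>(t, i). t @ [i]) ` (SIGMA t : ?T n. {i. \<sigma> t i \<noteq> 0})"
  proof (intro set_eqI iffI)
    fix t
    assume t: "t \<in> ?T (Suc n)"
    then show "t \<in> (\<lambda>(t, i). t @ [i]) ` (SIGMA t : ?T n. {i. \<sigma> t i \<noteq> 0})"
      by (cases t rule: rev_cases) force+
  qed auto
  have "(\<Sum>t\<in>?T (Suc n). word_mass \<sigma> t) =
      (\<Sum>(t, i)\<in>(SIGMA t : ?T n. {i. \<sigma> t i \<noteq> 0}). \<sigma> t i)"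
    unfolding eq by (subst sum.reindex) (auto simp: inj_on_def word_mass_def intro!: sum.cong)
  also have "\<dots> = (\<Sum>t\<in>?T n. \<Sum>i | \<sigma> t i \<noteq> 0. \<sigma> t i)"
    by (subst sum.Sigma) auto
  also have "\<dots> = (\<Sum>t\<in>?T n. word_mass \<sigma> t)"
  proof (rule sum.cong)
    fix t
    assume "t \<in> ?T n"
    have "(\<Sum>i | \<sigma> t i \<noteq> 0. \<sigma> t i) = (\<Sum>i\<in>UNIV. \<sigma> t i)"
      by (rule sum.mono_neutral_left) auto
    with \<open>t \<in> ?T n\<close> show "(\<Sum>i | \<sigma> t i \<noteq> 0. \<sigma> t i) = word_mass \<sigma> t"
      by (simp add: reachable_imp_mass)
  qed simp
  finally show ?case
    using Suc by simp
qed

lemma all_reachable_imp_notin: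
  assumes "\<And>n. reachable \<sigma> (initial x n)"
  shows "x \<notin> P"
proof -
  have "I_wins_run w s P (\<lambda>n. \<sigma> (initial x n)) x"
    using win by (simp add: winning_strategy_I_def)
  then show ?thesis
    using assms unfolding I_wins_run_def reachable_initial_iff by auto
qed

end

subsection \<open>Fubini for the measure game\<close>

text \<open>By Fubini, the measure of \<open>U\<close> is the integral of its sections. These
  contribute at most 1 at points of the set in question and less than \<open>e\<close>
  elsewhere.\<close>

lemma (in prob_space) measure_section_ge:
  assumes "U \<in> sets (M \<Otimes>\<^sub>M M)" and c: "c \<le> measure (M \<Otimes>\<^sub>M M) U" and "0 \<le> e"
    and V: "{x \<in> space M. e \<le> measure M (Pair x -` U)} \<in> sets M"
  shows "c - e \<le> measure M {x \<in> space M. e \<le> measure M (Pair x -` U)}"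
proof -
  interpret pair: pair_prob_space M M ..
  let ?V = "{x \<in> space M. e \<le> measure M (Pair x -` U)}"
  have "emeasure (M \<Otimes>\<^sub>M M) U = (\<integral>\<^sup>+x. emeasure M (Pair x -` U) \<partial>M)"
    using assms(1) by (rule emeasure_pair_measure_alt)
  also have "\<dots> \<le> (\<integral>\<^sup>+x. indicator ?V x + ennreal e \<partial>M)"
  proof (rule nn_integral_mono)
    fix x assume x: "x \<in> space M"
    show "emeasure M (Pair x -` U) \<le> indicator ?V x + ennreal e"
    proof (cases "x \<in> ?V")
      case True
      have "emeasure M (Pair x -` U) \<le> 1 + 0"
        by (simp add: emeasure_le_1)
      also have "\<dots> \<le> 1 + ennreal e"
        by (intro add_mono) auto
      finally show ?thesis
        using True by simp
    next
      case False
      then show ?thesis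
        using x by (auto simp: emeasure_eq_measure intro!: ennreal_leI)
    qed
  qed
  also have "\<dots> = emeasure M ?V + ennreal e"
    using V by (subst nn_integral_add) (auto simp: emeasure_space_1)
  also have "\<dots> = ennreal (measure M ?V + e)"
    using \<open>0 \<le> e\<close> by (simp add: emeasure_eq_measure)
  finally have "measure (M \<Otimes>\<^sub>M M) U \<le> measure M ?V + e"
    using \<open>0 \<le> e\<close> by (simp add: pair.P.emeasure_eq_measure del: ennreal_plus)
  with c show ?thesis
    by simp
qed

theorem theorem4p5:
  fixes \<mu> :: "(nat \<Rightarrow> bool) measure"
    and A :: "((nat \<Rightarrow> bool) \<times> (nat \<Rightarrow> bool)) set"
  assumes "prob_space \<mu>"
    and "sets \<mu> = sets borel"
    and "I_wins_G2 \<mu> 0 A"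
  shows "I_wins_G \<mu> 0 {x. \<not> I_wins_G \<mu> 0 {y. (x, y) \<in> A}}"
proof -
  interpret prob_space \<mu> by fact
  interpret pair: pair_prob_space \<mu> \<mu> ..
  have space: "space \<mu> = UNIV"
    using sets_eq_imp_space_eq[OF assms(2)] by simp
  let ?C = "\<lambda>t. cyl (map fst t) \<times> cyl (map snd t)"
  let ?w = "\<lambda>t. measure (\<mu> \<Otimes>\<^sub>M \<mu>) (?C t)"
  let ?z = "\<lambda>x y k. (x k, y k)"
  obtain \<sigma> where \<sigma>: "winning_strategy_I ?w 0 {z. (fst \<circ> z, snd \<circ> z) \<in> A} \<sigma>"
    using assms(3) unfolding I_wins_G2_def by blast
  define c where "c = word_mass \<sigma> []"
  have "c > 0"
    using word_mass_Nil_greater[OF \<sigma>] by (simp add: c_def)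
  \<comment> \<open>The intersection of all \<open>U n\<close> consists of the infinite branches of
    the tree of reachable words.\<close>
  define U where "U n = {(x, y). reachable \<sigma> (initial (?z x y) n)}" for n
  \<comment> \<open>The threshold \<open>c / 2\<close> leaves measure at least
    \<open>c - c / 2 > 0\<close> for \<open>V n\<close>, and is itself a positive bound on sections
    that survives the limit in \<open>n\<close>.\<close>
  define V where "V n = {x. c / 2 \<le> measure \<mu> (Pair x -` U n)}" for n
  have C_sets: "?C t \<in> sets (\<mu> \<Otimes>\<^sub>M \<mu>)" for t
    by (intro pair_measureI) (simp_all add: assms(2))
  have C_disjoint: "?C t \<inter> ?C t' = {}" if "length t = length t'" "t \<noteq> t'" for t t'
    using that initial_pair_eq_iff[of _ _ t] initial_pair_eq_iff[of _ _ t'] by fastforce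
  have U_eq: "U n = (\<Union>t\<in>{t. length t = n \<and> reachable \<sigma> t}. ?C t)" for n
  proof -
    have "(x, y) \<in> U n \<longleftrightarrow>
        (\<exists>t. length t = n \<and> reachable \<sigma> t \<and> initial (?z x y) (length t) = t)" for x y
      unfolding U_def by (metis (no_types, lifting) case_prodD case_prodI length_initial mem_Collect_eq)
    then show ?thesis
      unfolding initial_pair_eq_iff by auto
  qed
  have U_sets: "U n \<in> sets (\<mu> \<Otimes>\<^sub>M \<mu>)" for n
    unfolding U_eq by (intro sets.finite_UN finite_words C_sets)
  \<comment> \<open>The total mass \<open>c\<close> is conserved on level \<open>n\<close>, where
    each mass is bounded by the measure of its rectangle, and these rectangles are disjoint.\<close>
  have U_measure: "c \<le> measure (\<mu> \<Otimes>\<^sub>M \<mu>) (U n)" for n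
  proof -
    have "c = (\<Sum>t | length t = n \<and> reachable \<sigma> t. word_mass \<sigma> t)"
      by (simp add: c_def sum_word_mass[OF \<sigma>])
    also have "\<dots> \<le> (\<Sum>t | length t = n \<and> reachable \<sigma> t. ?w t)"
      by (intro sum_mono) (simp add: reachable_imp_mass[OF \<sigma>])
    also have "\<dots> = measure (\<mu> \<Otimes>\<^sub>M \<mu>) (U n)"
      unfolding U_eq
      by (intro pair.P.finite_measure_finite_Union[symmetric])
        (use C_disjoint in \<open>auto simp: disjoint_family_on_def C_sets\<close>)
    finally show ?thesis .
  qed
  have U_Suc: "U (Suc n) \<subseteq> U n" for n
    by (auto simp: U_def initial_Suc)
  have section_sets: "Pair x -` U n \<in> sets \<mu>" for x n
    using U_sets by (rule sets_Pair1)
  have initial_pair: "initial (?z x y) n = initial (?z x' y') n"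
    if "initial x n = initial x' n" "initial y n = initial y' n" for x x' y y' n
    using that by (auto simp: initial_eq_iff)
  have det_section: "y' \<in> Pair x -` U n" if "initial y n = initial y' n" "y \<in> Pair x -` U n" for x y y' n
    using that initial_pair[of x n x y y'] by (simp add: U_def)
  have det_V: "x' \<in> V n" if "initial x n = initial x' n" "x \<in> V n" for x x' n
  proof -
    have "(x, y) \<in> U n \<longleftrightarrow> (x', y) \<in> U n" for y
      using initial_pair[OF that(1), of y y] by (simp add: U_def)
    then have "Pair x -` U n = Pair x' -` U n"
      by auto
    with that show ?thesis
      by (simp add: V_def)
  qed
  have V_sets: "V n \<in> sets \<mu>" for n
    unfolding assms(2) by (rule determined_borel) (rule det_V)
  have V_measure: "c / 2 \<le> measure \<mu> (V n)" for n
    using measure_section_ge[OF U_sets U_measure, of "c / 2" n] V_sets[of n] \<open>c > 0\<close>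
    by (simp add: V_def space)
  have "measure \<mu> (Pair x -` U (Suc n)) \<le> measure \<mu> (Pair x -` U n)" for x n
    using U_Suc section_sets by (intro finite_measure_mono vimage_mono)
  then have "decseq V"
    unfolding decseq_Suc_iff V_def by (auto intro: order_trans)
  with V_sets V_measure have "c / 2 \<le> measure \<mu> (\<Inter>n. V n)"
    by (intro measure_INT_decseq_ge)
  with \<open>c > 0\<close> have V_pos: "measure \<mu> (\<Inter>n. V n) > 0"
    by linarith
  have "I_wins_G \<mu> 0 {y. (x, y) \<in> A}" if x: "x \<in> (\<Inter>n. V n)" for x
  proof (rule closed_imp_I_wins_G[where U = "\<lambda>n. Pair x -` U n"])
    have "decseq (\<lambda>n. Pair x -` U n)"
      using U_Suc by (auto simp: decseq_Suc_iff)
    then have "c / 2 \<le> measure \<mu> (\<Inter>n. Pair x -` U n)"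
      using x section_sets by (intro measure_INT_decseq_ge) (auto simp: V_def)
    with \<open>c > 0\<close> show "measure \<mu> (\<Inter>n. Pair x -` U n) > 0"
      by linarith
    \<comment> \<open>Here II never breaks a rule when playing the pair, so the winning strategy
      \<open>\<sigma>\<close> forces the pair out of \<open>A\<close>.\<close>
    have "(x, y) \<notin> A" if "y \<in> (\<Inter>n. Pair x -` U n)" for y
      using all_reachable_imp_notin[OF \<sigma>, of "?z x y"] that by (auto simp: U_def comp_def)
    then show "(\<Inter>n. Pair x -` U n) \<inter> {y. (x, y) \<in> A} = {}"
      by auto
  qed (fact assms det_section)+
  \<comment> \<open>The criterion used for the sections is now applied a second time, to the sets
    \<open>V n\<close> and the payoff set of the first coordinate.\<close>
  then have "(\<Inter>n. V n) \<inter> {x. \<not> I_wins_G \<mu> 0 {y. (x, y) \<in> A}} = {}"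
    by blast
  with assms(1,2) det_V V_pos show ?thesis
    by (rule closed_imp_I_wins_G)
qed

end
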